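(* Let $p$ be a prime with $p\equiv1\pmod 4$, and write $p=c^2+d^2$ with $c,d\in\mathbb Z$ and $2\mid d$. Let $b,m\in\mathbb Z$ with $\gcd(b,m)=1$ and $p\nmid m(b^2+4m^2)$. Then $$\Big(\frac mp\Big)\sum_{k=0}^{(p-1)/4}\binom{4k}{2k}\Big(-\frac{b^2}{64m^2}\Big)^k\equiv\Big(\frac bp\Big)\sum_{k=0}^{(p-1)/4}\binom{4k}{2k}\Big(-\frac{m^2}{4b^2}\Big)^k$$ $$\equiv\begin{cases}\Big(\frac{bc+2md}{b^2+4m^2}\Big)\pmod p&\text{if }2\nmid b\text{ and }\big(\frac{b^2+4m^2}{p}\big)=1,\\[2pt] (-1)^{\frac{((b/2)c+md)^2-1}{8}+\frac d2}\Big(\frac{(b/2)c+md}{((b/2)^2+m^2)/2}\Big)\pmod p&\text{if }2\,\|\,b\text{ and }\big(\frac{b^2+4m^2}{p}\big)=1,\\[2pt] \Big(\frac{mc-(b/2)d}{b^2/4+m^2}\Big)\pmod p&\text{if }4\mid b\text{ and }\big(\frac{b^2+4m^2}{p}\big)=1,\\[2pt] 0\pmod p&\text{if }\big(\frac{b^2+4m^2}{p}\big)=-1.\end{cases}$$ In particular, for $a\in\mathbb Z$ with $p\nmid 16a^2+1$, $$\sum_{k=0}^{(p-1)/4}\binom{4k}{2k}(-a^2)^k\equiv\Big(\frac{2a}p\Big)\sum_{k=0}^{(p-1)/4}\binom{4k}{2k}\frac1{(-256a^2)^k}\equiv\begin{cases}\Big(\frac{c-4ad}{16a^2+1}\Big)\pmod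 p&\text{if }\big(\frac{16a^2+1}p\big)=1,\\ 0\pmod p&\text{if }\big(\frac{16a^2+1}p\big)=-1.\end{cases}$$
   Context: For rational numbers whose denominators are prime to $p$, congruences modulo $p$ are understood in the ring of such rationals. $\big(\frac{x}{n}\big)$ denotes the Legendre–Jacobi symbol (for odd positive $n$); $\big(\frac{x}{p}\big)$ for such a rational $x$ means the Legendre symbol of its residue mod $p$. $2\,\|\,b$ means $2\mid b$ but $4\nmid b$.
   Formalization: Congruences involving the second sum (with b², resp. a², in the denominator) are claimed only when p∤b (resp. p∤a), since they fail or are undefined otherwise; the congruence of the first sum with the case value is proved without this restriction. *)

theory Defs
  imports Complex_Main "HOL-Number_Theory.Number_Theory"
begin

text \<open>Congruence modulo \<open>p\<close> in the ring of rationals whose denominator is prime to \<open>p\<close>.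
  Both sides are required to lie in that ring.\<close>

definition p_integral :: "nat \<Rightarrow> rat \<Rightarrow> bool" where
  "p_integral p x \<longleftrightarrow> coprime (snd (quotient_of x)) (int p)"

definition rat_cong :: "nat \<Rightarrow> rat \<Rightarrow> rat \<Rightarrow> bool" where
  "rat_cong p x y \<longleftrightarrow>
     p_integral p x \<and> p_integral p y \<and> (\<exists>z. p_integral p z \<and> x - y = of_nat p * z)"

text \<open>The Legendre--Jacobi symbol; meaningful for odd positive \<open>n\<close> only.\<close>

definition Jacobi :: "int \<Rightarrow> int \<Rightarrow> int" where
  "Jacobi a n = (\<Prod>q\<in>#prime_factorization n. Legendre a q)"

definition central_sum :: "nat \<Rightarrow> rat \<Rightarrow> rat" where
  "central_sum p x = (\<Sum>k = 0..(p - 1) div 4. of_nat ((4 * k) choose (2 * k)) * x ^ k)"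

end

theory Submission
  imports Defs "HOL-Computational_Algebra.Squarefree"
begin

text \<open>
  Modulo an odd prime \<open>p = 2h + 1\<close> one has \<open>binom(2j, j) \<equiv> (-4)^j binom(h, j)\<close>, so if
  \<open>x \<equiv> y\<^sup>2\<close> the even part of the binomial expansion of \<open>(1 + 4y)^h\<close> shows that twice the sum at
  \<open>x\<close> is \<open>((1 - 4y)/p) + ((1 + 4y)/p)\<close>. When \<open>p = c\<^sup>2 + d\<^sup>2\<close>, the argument \<open>x = - f\<^sup>2/(16e\<^sup>2)\<close> is the
  square of \<open>y = fd/(4ec)\<close>, which turns these symbols into \<open>((ec - fd)/p)\<close> and \<open>((ec + fd)/p)\<close>.
  Their product is \<open>((e\<^sup>2 + f\<^sup>2)/p)\<close>, so they cancel or coincide. The two sums of the theorem have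
  the arguments for \<open>(e, f) = (b, 2m)\<close> and \<open>(2m, b)\<close>; exchanging \<open>e\<close> and \<open>f\<close> multiplies the value
  by \<open>(d/p) = (2/p)\<close>.

  To turn \<open>((uc + vd)/p)\<close> into a Jacobi symbol, put \<open>t = uc + vd\<close>, \<open>s = ud - vc\<close> and
  \<open>u\<^sup>2 + v\<^sup>2 = en\<close> with \<open>n\<close> odd. Then \<open>s\<^sup>2 + t\<^sup>2 = enp\<close> with \<open>s\<close> and \<open>t\<close> coprime, so \<open>enp\<close> is a
  square modulo \<open>t\<close> and all prime factors of \<open>np\<close> are \<open>1\<close> modulo \<open>4\<close>. Reciprocity gives
  \<open>(t/p)(t/n) = (np/t) = (e/t)\<close>; the cases of the theorem use \<open>e = 1\<close> and \<open>e = 2\<close>.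
\<close>

section \<open>Legendre and Jacobi symbols\<close>

lemma odd_prime_gt_2_int:
  fixes q :: int
  assumes "prime q" "odd q"
  shows "2 < q"
  using assms prime_ge_2_int[of q] by (cases "q = 2") auto

lemma Legendre_range: "Legendre a q \<in> {-1, 0, 1}"
  by (simp add: Legendre_def)

lemma Legendre_eq_0_iff: "Legendre a q = 0 \<longleftrightarrow> q dvd a"
  by (simp add: Legendre_def cong_0_iff)

lemma Legendre_cong:
  assumes "[a = b] (mod q)"
  shows "Legendre a q = Legendre b q"
proof -
  have "[a = 0] (mod q) \<longleftrightarrow> [b = 0] (mod q)" "QuadRes q a \<longleftrightarrow> QuadRes q b"
    using assms unfolding QuadRes_def by (meson cong_sym cong_trans)+
  then show ?thesis by (simp add: Legendre_def)
qed

lemma Legendre_square: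
  assumes "prime q" "\<not> q dvd a"
  shows "Legendre (a\<^sup>2) q = 1"
  using assms by (auto simp: Legendre_def cong_0_iff QuadRes_def dest: prime_dvd_power intro: cong_refl)

lemma euler_criterion_int:
  fixes q :: int
  assumes "prime q" "odd q"
  shows "[Legendre a q = a ^ nat ((q - 1) div 2)] (mod q)"
proof -
  have "prime (nat q)" "2 < nat q" "int (nat q) = q" "(nat q - 1) div 2 = nat ((q - 1) div 2)"
    using assms odd_prime_gt_2_int[OF assms] by auto
  then show ?thesis
    using euler_criterion[of "nat q" a] by simp
qed

lemma cong_sign_imp_eq:
  fixes x y q :: int
  assumes "[x = y] (mod q)" "2 < q" "x \<in> {-1, 0, 1}" "y \<in> {-1, 0, 1}"
  shows "x = y"
proof (rule ccontr)
  assume "x \<noteq> y"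
  moreover have "q dvd x - y"
    using assms(1) by (simp add: cong_iff_dvd_diff)
  ultimately have "\<bar>q\<bar> \<le> \<bar>x - y\<bar>"
    by (intro dvd_imp_le_int) auto
  then show False using assms(2-4) by auto
qed

lemma Legendre_mult:
  fixes q :: int
  assumes "prime q" "odd q"
  shows "Legendre (a * b) q = Legendre a q * Legendre b q"
proof (rule cong_sign_imp_eq)
  have "[a ^ nat ((q - 1) div 2) * b ^ nat ((q - 1) div 2) = Legendre a q * Legendre b q] (mod q)"
    by (intro cong_mult cong_sym[OF euler_criterion_int] assms)
  then show "[Legendre (a * b) q = Legendre a q * Legendre b q] (mod q)"
    using cong_trans[OF euler_criterion_int[OF assms, of "a * b"]] by (simp add: power_mult_distrib)
  show "Legendre a q * Legendre b q \<in> {-1, 0, 1}"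
    using Legendre_range[of a q] Legendre_range[of b q] by auto
qed (fact odd_prime_gt_2_int[OF assms] Legendre_range)+

lemma Legendre_minus_one:
  fixes q :: int
  assumes "prime q" "odd q"
  shows "Legendre (- 1) q = (if [q = 1] (mod 4) then 1 else - 1)"
proof (rule cong_sign_imp_eq)
  have "even (nat ((q - 1) div 2)) \<longleftrightarrow> [q = 1] (mod 4)"
    using assms odd_prime_gt_2_int[OF assms] by (simp add: even_nat_iff cong_def) presburger
  then have "(- 1) ^ nat ((q - 1) div 2) = (if [q = 1] (mod 4) then 1 else - 1 :: int)"
    by (simp add: minus_one_power_iff)
  then show "[Legendre (- 1) q = (if [q = 1] (mod 4) then 1 else - 1)] (mod q)"
    using euler_criterion_int[OF assms, of "- 1"] by argo
qed (simp_all add: odd_prime_gt_2_int[OF assms] Legendre_range[simplified])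

lemma Legendre_two_eq_minus_one_power:
  fixes h :: nat
  assumes "prime (2 * h + 1)"
  shows "Legendre 2 (int (2 * h + 1)) = (- 1) ^ (h - h div 2)"
proof -
  have h: "0 < h" using assms by (cases h) auto
  interpret GAUSS "2 * h + 1" 2
  proof
    show "[2 \<noteq> 0] (mod int (2 * h + 1))"
      using h by (auto simp: cong_0_iff dest: zdvd_imp_le)
  qed (use assms h in auto)
  have half: "(int (2 * h + 1) - 1) div 2 = int h" by simp
  have "C = (\<lambda>x. x * 2) ` {0<..int h}"
    unfolding C_def B_def A_def half image_image by (rule image_cong) auto
  then have "E = (\<lambda>x. x * 2) ` {int (h div 2)<..int h}"
    unfolding E_def half by (auto simp: zdiv_int)
  then have "card E = h - h div 2"
    by (simp add: card_image inj_on_def)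
  then show ?thesis using gauss_lemma by simp
qed

lemma Legendre_two:
  fixes q :: int
  assumes "prime q" "odd q"
  shows "Legendre 2 q = (if q mod 8 \<in> {1, 7} then 1 else - 1)"
proof -
  define h where "h = nat (q div 2)"
  have q: "q = int (2 * h + 1)"
    using odd_prime_gt_2_int[OF assms] assms(2) by (simp add: h_def) presburger
  have "even (h - h div 2) \<longleftrightarrow> q mod 8 \<in> {1, 7}"
    unfolding q by simp presburger
  moreover have "Legendre 2 q = (- 1) ^ (h - h div 2)"
    using assms(1) unfolding q by (intro Legendre_two_eq_minus_one_power) (simp only: prime_nat_int_transfer)
  ultimately show ?thesis by (simp only: minus_one_power_iff)
qed

lemma cong_1_mod_4_imp_odd:
  fixes q :: int
  assumes "[q = 1] (mod 4)"
  shows "odd q"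
  using assms unfolding cong_def by presburger

lemma Legendre_reciprocity:
  fixes q r :: int
  assumes "prime q" "[q = 1] (mod 4)" "prime r" "odd r"
  shows "Legendre r q = Legendre q r"
proof (cases "q = r")
  case False
  have gt_2: "2 < q" "2 < r"
    using assms cong_1_mod_4_imp_odd odd_prime_gt_2_int by blast+
  have "even ((q - 1) div 2)"
    using assms(2) by (simp add: cong_def) presburger
  then have "even (nat ((q - 1) div 2 * ((r - 1) div 2)))"
    using gt_2 by (simp add: even_nat_iff)
  then have "Legendre q r * Legendre r q = 1"
    using Quadratic_Reciprocity_int[of q r] assms gt_2 False by simp
  then show ?thesis by (auto simp: zmult_eq_1_iff)
qed simp

lemma Jacobi_prime: "prime q \<Longrightarrow> Jacobi a q = Legendre a q"
  by (simp add: Jacobi_def prime_factorization_prime)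

lemma Jacobi_unit: "is_unit n \<Longrightarrow> Jacobi a n = 1"
  by (simp add: Jacobi_def prime_factorization_unit)

lemma Jacobi_mult_right:
  "m \<noteq> 0 \<Longrightarrow> n \<noteq> 0 \<Longrightarrow> Jacobi a (m * n) = Jacobi a m * Jacobi a n"
  by (simp add: Jacobi_def prime_factorization_mult)

lemma Jacobi_mult_left:
  assumes "odd n"
  shows "Jacobi (a * b) n = Jacobi a n * Jacobi b n"
proof -
  have "odd q" if "q \<in># prime_factorization n" for q
    using that assms dvd_trans by blast
  then have "Jacobi (a * b) n = (\<Prod>q\<in>#prime_factorization n. Legendre a q * Legendre b q)"
    unfolding Jacobi_def
    by (intro arg_cong[of _ _ prod_mset] image_mset_cong Legendre_mult) auto
  then show ?thesis by (simp add: Jacobi_def prod_mset.distrib)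
qed

lemma Jacobi_cong:
  assumes "[a = b] (mod n)"
  shows "Jacobi a n = Jacobi b n"
  unfolding Jacobi_def
  by (intro arg_cong[of _ _ prod_mset] image_mset_cong Legendre_cong)
     (use assms in \<open>auto simp: in_prime_factors_iff intro: cong_dvd_modulus\<close>)

lemma Jacobi_square:
  assumes "coprime a n"
  shows "Jacobi (a\<^sup>2) n = 1"
proof -
  have "Jacobi (a\<^sup>2) n = (\<Prod>q\<in>#prime_factorization n. 1)"
    unfolding Jacobi_def
  proof (intro arg_cong[of _ _ prod_mset] image_mset_cong Legendre_square)
    fix q assume "q \<in># prime_factorization n"
    then have "prime q" "q dvd n" by (auto simp: in_prime_factors_iff)
    then show "prime q" "\<not> q dvd a"
      using assms not_prime_unit coprime_common_divisor by blast+
  qed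
  then show ?thesis by simp
qed

lemma Jacobi_one_left: "Jacobi 1 n = 1"
  using Jacobi_square[of 1 n] by simp

lemma even_square_minus_one_div_8:
  fixes t :: int
  assumes "odd t"
  shows "even ((t\<^sup>2 - 1) div 8) \<longleftrightarrow> t mod 8 \<in> {1, 7}"
proof -
  define k r where "k = t div 8" and "r = t mod 8"
  have t: "t = 8 * k + r" by (simp add: k_def r_def)
  have r: "r \<in> {1, 3, 5, 7}" unfolding r_def using assms by simp presburger
  have "t\<^sup>2 - 1 = (r\<^sup>2 - 1) + 8 * (2 * (4 * k\<^sup>2 + k * r))"
    unfolding t by (simp add: power2_eq_square algebra_simps)
  then have "(t\<^sup>2 - 1) div 8 = (r\<^sup>2 - 1) div 8 + 2 * (4 * k\<^sup>2 + k * r)"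
    by simp
  then have "even ((t\<^sup>2 - 1) div 8) \<longleftrightarrow> even ((r\<^sup>2 - 1) div 8)" by simp
  also have "\<dots> \<longleftrightarrow> r \<in> {1, 7}" using r by auto
  finally show ?thesis by (simp only: r_def)
qed

lemma odd_square_eq:
  fixes t :: int
  assumes "odd t"
  shows "t\<^sup>2 = 8 * ((t\<^sup>2 - 1) div 8) + 1"
proof -
  obtain k where k: "t = 2 * k + 1" using assms by (auto elim: oddE)
  have "even (k * (k + 1))" by simp
  then obtain l where "k * (k + 1) = 2 * l" by (rule evenE)
  then have "t\<^sup>2 - 1 = 8 * l"
    unfolding k by (simp add: power2_eq_square algebra_simps)
  then show ?thesis by simp
qed

lemma Jacobi_two:
  assumes "odd n"
  shows "Jacobi 2 n = (if even ((n\<^sup>2 - 1) div 8) then 1 else - 1)"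
  using assms
proof (induction n rule: prime_divisors_induct)
  case (unit n)
  then have "n = 1 \<or> n = - 1" by auto
  with unit show ?case by (auto simp: Jacobi_unit)
next
  case (factor q n)
  define x y where "x = (q\<^sup>2 - 1) div 8" and "y = (n\<^sup>2 - 1) div 8"
  have odd: "odd q" "odd n" using factor.prems by auto
  have "((q * n)\<^sup>2 - 1) div 8 = 8 * x * y + x + y"
    using odd_square_eq[OF odd(1)] odd_square_eq[OF odd(2)]
    by (simp add: x_def[symmetric] y_def[symmetric] power_mult_distrib algebra_simps)
  moreover have "Legendre 2 q = (if even x then 1 else - 1)"
    using factor.hyps odd(1) Legendre_two[of q] even_square_minus_one_div_8[of q]
    by (simp add: x_def)
  moreover have "Jacobi 2 (q * n) = Legendre 2 q * Jacobi 2 n"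
    using factor.hyps odd by (subst Jacobi_mult_right) (auto simp: Jacobi_prime)
  ultimately show ?case using factor.IH odd by (simp add: y_def)
qed simp

lemma Legendre_Jacobi_reciprocity:
  fixes q m :: int
  assumes "prime q" "[q = 1] (mod 4)" "odd m"
  shows "Legendre m q = Jacobi q m"
  using assms(3)
proof (induction m rule: prime_divisors_induct)
  case (unit m)
  have "Legendre 1 q = 1" "Legendre (- 1) q = 1"
    using Jacobi_one_left[of q] Jacobi_prime[of q] Legendre_minus_one[of q]
      assms(1,2) cong_1_mod_4_imp_odd by simp_all
  moreover have "m = 1 \<or> m = - 1" using unit by auto
  ultimately show ?case using unit by (auto simp: Jacobi_unit)
next
  case (factor r m)
  then have r: "prime r" "odd r" "odd m" by auto
  have "Legendre (r * m) q = Legendre r q * Legendre m q"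
    using assms(1) cong_1_mod_4_imp_odd[OF assms(2)] by (rule Legendre_mult)
  also have "\<dots> = Jacobi q r * Jacobi q m"
    using factor.IH r Legendre_reciprocity[OF assms(1,2) r(1,2)] by (simp add: Jacobi_prime)
  also have "\<dots> = Jacobi q (r * m)"
    using r by (intro Jacobi_mult_right[symmetric]) auto
  finally show ?case .
qed simp

lemma Jacobi_reciprocity:
  fixes n m :: int
  assumes "\<And>q. prime q \<Longrightarrow> q dvd n \<Longrightarrow> [q = 1] (mod 4)" "0 < n" "odd m"
  shows "Jacobi m n = Jacobi n m"
  using assms(1,2)
proof (induction n rule: prime_divisors_induct)
  case (unit n)
  then have "n = 1" by auto
  then show ?case by (simp add: Jacobi_unit Jacobi_one_left)
next
  case (factor q n)
  then have q: "prime q" "[q = 1] (mod 4)" "0 < q" by (auto simp: prime_gt_0_int)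
  then have n: "0 < n" using factor.prems(2) by (simp add: zero_less_mult_iff)
  have "Jacobi m (q * n) = Legendre m q * Jacobi m n"
    using q n by (simp add: Jacobi_mult_right Jacobi_prime)
  also have "\<dots> = Jacobi q m * Jacobi n m"
    using factor.IH factor.prems n Legendre_Jacobi_reciprocity[OF q(1,2) assms(3)] by simp
  finally show ?case using assms(3) by (simp add: Jacobi_mult_left)
qed simp

section \<open>Sums of two squares\<close>

lemma prime_factor_sum_squares_cong_1:
  fixes u v r :: int
  assumes "coprime u v" "prime r" "odd r" "r dvd u\<^sup>2 + v\<^sup>2"
  shows "[r = 1] (mod 4)"
proof -
  have "r dvd u \<longleftrightarrow> r dvd v"
    using assms(2,4) dvd_add_left_iff dvd_add_right_iff prime_dvd_power_iff[of r 2]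
    by (metis zero_less_numeral)
  then have not_dvd: "\<not> r dvd u" "\<not> r dvd v"
    using assms(1,2) not_prime_unit coprime_common_divisor by blast+
  have "[u\<^sup>2 = - 1 * v\<^sup>2] (mod r)"
    using assms(4) by (simp add: cong_iff_dvd_diff)
  then have "Legendre (u\<^sup>2) r = Legendre (- 1) r * Legendre (v\<^sup>2) r"
    using Legendre_cong Legendre_mult[OF assms(2,3)] by metis
  then have "Legendre (- 1) r = 1"
    using not_dvd assms(2) by (simp add: Legendre_square)
  then show ?thesis
    using Legendre_minus_one[OF assms(2,3)] by (auto split: if_splits)
qed

text \<open>\<open>(c + di)(u - vi) = (uc + vd) + (ud - vc)i\<close>.\<close>

lemma coprime_Gaussian_product:
  fixes c d u v :: int
  assumes "coprime c d" "coprime u v" "coprime (c\<^sup>2 + d\<^sup>2) (u\<^sup>2 + v\<^sup>2)"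
  shows "coprime (u * d - v * c) (u * c + v * d)"
proof (rule coprimeI)
  have common_divisor: "r dvd z" if "coprime x y" "r dvd x * z" "r dvd y * z" for r x y z :: int
  proof -
    have "r dvd gcd (x * z) (y * z)" using that by simp
    then show ?thesis using that(1) by (simp add: gcd_mult_right gcd.commute)
  qed
  have parts: "c * (u * c + v * d) + d * (u * d - v * c) = u * (c\<^sup>2 + d\<^sup>2)"
      "d * (u * c + v * d) - c * (u * d - v * c) = v * (c\<^sup>2 + d\<^sup>2)"
      "u * (u * c + v * d) - v * (u * d - v * c) = c * (u\<^sup>2 + v\<^sup>2)"
      "v * (u * c + v * d) + u * (u * d - v * c) = d * (u\<^sup>2 + v\<^sup>2)"
    by (simp_all add: power2_eq_square algebra_simps)
  fix r assume "r dvd u * d - v * c" "r dvd u * c + v * d"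
  then have "r dvd u * (c\<^sup>2 + d\<^sup>2)" "r dvd v * (c\<^sup>2 + d\<^sup>2)"
    "r dvd c * (u\<^sup>2 + v\<^sup>2)" "r dvd d * (u\<^sup>2 + v\<^sup>2)"
    unfolding parts[symmetric] by (blast intro: dvd_add dvd_diff dvd_mult)+
  then have "r dvd c\<^sup>2 + d\<^sup>2" "r dvd u\<^sup>2 + v\<^sup>2"
    using assms(1,2) common_divisor by blast+
  then show "is_unit r" using assms(3) coprime_common_divisor by blast
qed

lemma Jacobi_sum_squares:
  fixes e n s t :: int
  assumes "coprime s t" "s\<^sup>2 + t\<^sup>2 = e * n" "0 < n" "odd n" "odd t"
  shows "Jacobi e t * Jacobi t n = 1"
proof -
  have "Jacobi t n = Jacobi n t"
  proof (rule Jacobi_reciprocity)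
    fix q assume "prime q" "q dvd n"
    then have "odd q" "q dvd s\<^sup>2 + t\<^sup>2"
      using assms(2,4) dvd_trans by auto
    then show "[q = 1] (mod 4)"
      using prime_factor_sum_squares_cong_1[OF assms(1) \<open>prime q\<close>] by blast
  qed (use assms in auto)
  then have "Jacobi e t * Jacobi t n = Jacobi (e * n) t"
    using assms(5) by (simp add: Jacobi_mult_left)
  also have "\<dots> = Jacobi (s\<^sup>2) t"
  proof (rule Jacobi_cong)
    have "e * n - s\<^sup>2 = t\<^sup>2" using assms(2) by simp
    then show "[e * n = s\<^sup>2] (mod t)"
      by (simp add: cong_iff_dvd_diff power2_eq_square)
  qed
  also have "\<dots> = 1" using assms(1) by (rule Jacobi_square)
  finally show ?thesis .
qed

section \<open>Congruences of rationals\<close>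

locale prime_modulus =
  fixes p :: nat
  assumes prime_p: "prime p"
begin

lemma prime_int_p: "prime (int p)"
  using prime_p by simp

lemma not_dvd_mult: "\<not> int p dvd a \<Longrightarrow> \<not> int p dvd b \<Longrightarrow> \<not> int p dvd a * b"
  using prime_int_p by (simp add: prime_dvd_mult_iff)

lemma coprime_p_iff: "coprime a (int p) \<longleftrightarrow> \<not> int p dvd a"
  using prime_int_p by (metis coprime_commute coprime_common_divisor dvd_refl not_prime_unit prime_imp_coprime)

lemma p_integral_iff: "p_integral p x \<longleftrightarrow> (\<exists>e. \<not> int p dvd e \<and> of_int e * x \<in> \<int>)"
proof -
  obtain a b where ab: "quotient_of x = (a, b)" by fastforce
  then have b: "0 < b" "coprime b a" and x: "x = of_int a / of_int b"
    by (simp_all add: quotient_of_denom_pos quotient_of_coprime quotient_of_div coprime_commute)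
  have "(\<exists>e. \<not> int p dvd e \<and> of_int e * x \<in> \<int>) \<longleftrightarrow> \<not> int p dvd b"
  proof
    assume "\<exists>e. \<not> int p dvd e \<and> of_int e * x \<in> \<int>"
    then obtain e z where e: "\<not> int p dvd e" "of_int e * x = of_int z" by (auto elim: Ints_cases)
    then have "of_int (e * a) = (of_int (z * b) :: rat)"
      using b(1) by (simp add: x field_simps)
    then have "b dvd e * a" by (metis dvd_triv_right of_int_eq_iff)
    then have "b dvd e" using b(2) by (simp add: coprime_dvd_mult_left_iff)
    then show "\<not> int p dvd b" using e(1) dvd_trans by blast
  next
    assume "\<not> int p dvd b"
    moreover have "of_int b * x \<in> \<int>" using b(1) by (simp add: x)
    ultimately show "\<exists>e. \<not> int p dvd e \<and> of_int e * x \<in> \<int>" by blast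
  qed
  then show ?thesis by (simp add: p_integral_def ab coprime_p_iff)
qed

lemma p_integral_of_int: "p_integral p (of_int a)"
  by (simp add: p_integral_def)

lemma p_integral_add:
  assumes "p_integral p x" "p_integral p y"
  shows "p_integral p (x + y)"
proof -
  obtain e f where "\<not> int p dvd e" "of_int e * x \<in> \<int>" "\<not> int p dvd f" "of_int f * y \<in> \<int>"
    using assms by (auto simp: p_integral_iff)
  moreover have "of_int (e * f) * (x + y) = of_int f * (of_int e * x) + of_int e * (of_int f * y)"
    by (simp add: algebra_simps)
  ultimately show ?thesis
    unfolding p_integral_iff by (metis Ints_add Ints_mult Ints_of_int not_dvd_mult)
qed

lemma p_integral_mult:
  assumes "p_integral p x" "p_integral p y"
  shows "p_integral p (x * y)"
proof -
  obtain e f where "\<not> int p dvd e" "of_int e * x \<in> \<int>" "\<not> int p dvd f" "of_int f * y \<in> \<int>"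
    using assms by (auto simp: p_integral_iff)
  moreover have "of_int (e * f) * (x * y) = (of_int e * x) * (of_int f * y)"
    by simp
  ultimately show ?thesis
    unfolding p_integral_iff by (metis Ints_mult not_dvd_mult)
qed

lemma p_integral_uminus: "p_integral p x \<Longrightarrow> p_integral p (- x)"
  using p_integral_mult[OF p_integral_of_int[of "- 1"]] by simp

lemma p_integral_cancel:
  assumes "p_integral p (of_int e * x)" "\<not> int p dvd e"
  shows "p_integral p x"
proof -
  obtain f where "\<not> int p dvd f" "of_int f * (of_int e * x) \<in> \<int>"
    using assms(1) by (auto simp: p_integral_iff)
  then have "of_int (f * e) * x \<in> \<int>" "\<not> int p dvd f * e"
    using assms(2) not_dvd_mult by (simp_all add: mult.assoc)
  then show ?thesis unfolding p_integral_iff by blast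
qed

lemma rat_cong_of_int:
  assumes "[a = b] (mod int p)"
  shows "rat_cong p (of_int a) (of_int b)"
proof -
  obtain k where "a - b = int p * k" using assms by (auto simp: cong_iff_dvd_diff)
  then have "of_int a - of_int b = of_nat p * (of_int k :: rat)"
    by (metis of_int_diff of_int_mult of_int_of_nat_eq)
  then show ?thesis unfolding rat_cong_def by (metis p_integral_of_int)
qed

lemma rat_cong_sym: "rat_cong p x y \<Longrightarrow> rat_cong p y x"
  unfolding rat_cong_def by (metis minus_diff_eq mult_minus_right p_integral_uminus)

lemma rat_cong_trans [trans]:
  assumes "rat_cong p x y" "rat_cong p y z"
  shows "rat_cong p x z"
proof -
  obtain u v where "p_integral p u" "x - y = of_nat p * u" "p_integral p v" "y - z = of_nat p * v"
    using assms unfolding rat_cong_def by blast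
  then have "p_integral p (u + v)" "x - z = of_nat p * (u + v)"
    by (simp_all add: p_integral_add algebra_simps)
  then show ?thesis using assms unfolding rat_cong_def by blast
qed

lemma rat_cong_common_value:
  assumes "rat_cong p x z" "Q \<Longrightarrow> rat_cong p y z"
  shows "rat_cong p x z \<and> (Q \<longrightarrow> rat_cong p x y \<and> rat_cong p y z)"
  using assms rat_cong_sym rat_cong_trans by blast

lemma rat_cong_add:
  assumes "rat_cong p x y" "rat_cong p x' y'"
  shows "rat_cong p (x + x') (y + y')"
proof -
  obtain u v where "p_integral p u" "x - y = of_nat p * u" "p_integral p v" "x' - y' = of_nat p * v"
    using assms unfolding rat_cong_def by blast
  then have "p_integral p (u + v)" "(x + x') - (y + y') = of_nat p * (u + v)"
    by (simp_all add: p_integral_add algebra_simps)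
  then show ?thesis using assms unfolding rat_cong_def by (meson p_integral_add)
qed

lemma rat_cong_mult:
  assumes "rat_cong p x y" "rat_cong p x' y'"
  shows "rat_cong p (x * x') (y * y')"
proof -
  obtain z z' where z: "p_integral p z" "x - y = of_nat p * z"
    "p_integral p z'" "x' - y' = of_nat p * z'"
    using assms unfolding rat_cong_def by blast
  have integral: "p_integral p x" "p_integral p x'" "p_integral p y" "p_integral p y'"
    using assms unfolding rat_cong_def by auto
  have "x * x' - y * y' = (x - y) * x' + y * (x' - y')" by (simp add: algebra_simps)
  also have "\<dots> = of_nat p * (z * x' + y * z')"
    unfolding z by (simp add: algebra_simps)
  finally have "x * x' - y * y' = of_nat p * (z * x' + y * z')" .
  moreover have "p_integral p (z * x' + y * z')"
    using integral z by (intro p_integral_add p_integral_mult)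
  ultimately show ?thesis
    using integral unfolding rat_cong_def by (meson p_integral_mult)
qed

lemma rat_cong_scale: "rat_cong p x y \<Longrightarrow> rat_cong p (of_int a * x) (of_int a * y)"
  using rat_cong_mult[OF rat_cong_of_int[OF cong_refl]] .

lemma rat_cong_cancel:
  assumes "rat_cong p (of_int e * x) (of_int e * y)" "\<not> int p dvd e"
  shows "rat_cong p x y"
proof -
  obtain z where z: "p_integral p z" "of_int e * x - of_int e * y = of_nat p * z"
    using assms(1) unfolding rat_cong_def by blast
  have "e \<noteq> 0" using assms(2) by auto
  then have "p_integral p (z / of_int e)"
    using z(1) assms(2) p_integral_cancel[of e "z / of_int e"] by simp
  moreover have "x - y = of_nat p * (z / of_int e)"
    using z(2) \<open>e \<noteq> 0\<close> by (simp add: field_simps)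
  ultimately show ?thesis
    using assms p_integral_cancel unfolding rat_cong_def by blast
qed

lemma rat_cong_power:
  assumes "rat_cong p x y"
  shows "rat_cong p (x ^ k) (y ^ k)"
proof (induction k)
  case 0
  then show ?case using rat_cong_of_int[of 1 1] by simp
next
  case (Suc k)
  then show ?case using rat_cong_mult[OF assms] by simp
qed

lemma rat_cong_sum:
  assumes "\<And>k. k \<in> K \<Longrightarrow> rat_cong p (f k) (g k)"
  shows "rat_cong p (sum f K) (sum g K)"
  using assms
proof (induction K rule: infinite_finite_induct)
  case (insert k K)
  then show ?case by (simp add: rat_cong_add)
qed (use rat_cong_of_int[of 0 0] in simp_all)

lemma neg_square_quotient_cong_square:
  fixes c d e f :: int
  assumes "int p dvd c\<^sup>2 + d\<^sup>2" "\<not> int p dvd c" "\<not> int p dvd e"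
  obtains y where "[e * c * y = f * d] (mod int p)"
    and "rat_cong p (- ((of_int f)\<^sup>2 / (of_int e)\<^sup>2)) (of_int (y\<^sup>2))"
proof -
  obtain i where i: "[e * c * i = 1] (mod int p)"
    using not_dvd_mult[OF assms(3,2)] cong_solve_coprime_int coprime_p_iff by blast
  define y where "y = i * (f * d)"
  have y: "[e * c * y = f * d] (mod int p)"
    using cong_scalar_right[OF i, of "f * d"] by (simp add: y_def mult.assoc)
  have "(f * d)\<^sup>2 + (c * f)\<^sup>2 = (c\<^sup>2 + d\<^sup>2) * f\<^sup>2"
    by (simp add: power_mult_distrib algebra_simps)
  then have "int p dvd (f * d)\<^sup>2 + (c * f)\<^sup>2"
    using assms(1) by simp
  then have "[(f * d)\<^sup>2 = - ((c * f)\<^sup>2)] (mod int p)"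
    by (simp add: cong_iff_dvd_diff)
  with cong_pow[OF y] have "[- ((c * f)\<^sup>2) = (e * c * y)\<^sup>2] (mod int p)"
    by (rule cong_sym[OF cong_trans])
  then have "rat_cong p (of_int (- ((c * f)\<^sup>2))) (of_int ((e * c * y)\<^sup>2))"
    by (rule rat_cong_of_int)
  moreover have "e \<noteq> 0" using assms(3) by auto
  ultimately have "rat_cong p (of_int ((e * c)\<^sup>2) * - ((of_int f)\<^sup>2 / (of_int e)\<^sup>2))
      (of_int ((e * c)\<^sup>2) * of_int (y\<^sup>2))"
    by (simp add: power_mult_distrib)
  moreover have "\<not> int p dvd (e * c)\<^sup>2"
    using not_dvd_mult[OF assms(3,2)] prime_int_p by (simp add: prime_dvd_power_iff)
  ultimately show ?thesis
    using that y rat_cong_cancel by blast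
qed

end

section \<open>Sums of central binomial coefficients\<close>

lemma Suc_times_central_binomial:
  "Suc j * ((2 * Suc j) choose Suc j) = 2 * (2 * j + 1) * ((2 * j) choose j)"
proof -
  have symmetric: "Suc (2 * j) choose j = Suc (2 * j) choose Suc j"
    using binomial_symmetric[of j "Suc (2 * j)"] by (simp add: Suc_diff_le)
  have "Suc j * (Suc (Suc (2 * j)) choose Suc j) = Suc (Suc (2 * j)) * (Suc (2 * j) choose j)"
    by (rule Suc_times_binomial)
  also have "\<dots> = 2 * (Suc j * (Suc (2 * j) choose Suc j))"
    unfolding symmetric by simp
  also have "\<dots> = 2 * (Suc (2 * j) * ((2 * j) choose j))"
    by (simp only: Suc_times_binomial)
  finally show ?thesis by simp
qed

lemma int_Suc_times_binomial_Suc: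
  "int (Suc j) * int (h choose Suc j) = (int h - int j) * int (h choose j)"
proof (cases "j \<le> h")
  case True
  have "Suc j * (h choose Suc j) = (h - j) * (h choose j)"
    by (simp only: binomial_absorption binomial_absorb_comp)
  then show ?thesis
    using True by (metis of_nat_diff of_nat_mult)
qed (simp add: binomial_eq_0)

lemma central_binomial_cong:
  fixes p h j :: nat
  assumes "prime p" "p = 2 * h + 1" "j < p"
  shows "[int ((2 * j) choose j) = (- 4) ^ j * int (h choose j)] (mod int p)"
  using assms(3)
proof (induction j)
  case (Suc j)
  have "2 * (2 * int j + 1) - - 4 * (int h - int j) = int p * 2"
    by (simp add: assms(2))
  then have ratio: "[2 * (2 * int j + 1) = - 4 * (int h - int j)] (mod int p)"
    by (simp only: cong_iff_dvd_diff dvd_triv_left)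
  have "int (Suc j) * int ((2 * Suc j) choose Suc j) = 2 * (2 * int j + 1) * int ((2 * j) choose j)"
    using Suc_times_central_binomial[of j, THEN arg_cong, of int]
    by (simp only: of_nat_mult of_nat_add of_nat_numeral of_nat_1)
  also have "[\<dots> = (- 4 * (int h - int j)) * ((- 4) ^ j * int (h choose j))] (mod int p)"
    using Suc by (intro cong_mult ratio) simp
  also have "(- 4 * (int h - int j)) * ((- 4) ^ j * int (h choose j))
      = (- 4) ^ Suc j * ((int h - int j) * int (h choose j))"
    by (simp add: algebra_simps)
  also have "\<dots> = int (Suc j) * ((- 4) ^ Suc j * int (h choose Suc j))"
    unfolding int_Suc_times_binomial_Suc[symmetric] by (rule mult.left_commute)
  finally have "[int (Suc j) * int ((2 * Suc j) choose Suc j)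
      = int (Suc j) * ((- 4) ^ Suc j * int (h choose Suc j))] (mod int p)" .
  moreover have "coprime (int (Suc j)) (int p)"
  proof -
    have "\<not> p dvd Suc j" using Suc.prems by (auto dest: dvd_imp_le)
    then show ?thesis using prime_imp_coprime[OF assms(1)] coprime_int_iff coprime_commute by blast
  qed
  ultimately show ?case by (simp only: cong_mult_lcancel)
qed simp

lemma sum_even_binomial_powers:
  fixes z :: "'a :: comm_ring_1"
  shows "(1 - z) ^ n + (1 + z) ^ n = 2 * (\<Sum>k = 0..n div 2. of_nat (n choose (2 * k)) * z ^ (2 * k))"
proof -
  have "(1 - z) ^ n + (1 + z) ^ n = (\<Sum>j\<le>n. of_nat (n choose j) * ((- z) ^ j + z ^ j))"
    using binomial_ring[of "- z" 1 n] binomial_ring[of z 1 n]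
    by (simp add: distrib_left sum.distrib add.commute)
  also have "\<dots> = (\<Sum>j | j \<le> n \<and> even j. 2 * (of_nat (n choose j) * z ^ j))"
    by (rule sum.mono_neutral_cong_right) (auto simp: mult.left_commute simp flip: mult_2)
  also have "\<dots> = (\<Sum>k = 0..n div 2. 2 * (of_nat (n choose (2 * k)) * z ^ (2 * k)))"
    by (rule sum.reindex_bij_witness[of _ "\<lambda>k. 2 * k" "\<lambda>j. j div 2"]) auto
  finally show ?thesis by (simp only: sum_distrib_left)
qed

locale odd_prime_modulus = prime_modulus +
  assumes odd_p: "odd p"
begin

abbreviation chi :: "int \<Rightarrow> int" ("\<chi>")
  where "\<chi> a \<equiv> Legendre a (int p)"

lemma odd_int_p: "odd (int p)"
  using odd_p by simp

lemma not_dvd_two_power: "\<not> int p dvd 2 ^ k"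
  by (simp add: coprime_p_iff[symmetric] odd_p)

lemma chi_mult: "\<chi> (a * b) = \<chi> a * \<chi> b"
  by (rule Legendre_mult[OF prime_int_p odd_int_p])

lemma central_sum_cong_square:
  assumes "rat_cong p x (of_int (y\<^sup>2))"
  shows "rat_cong p (2 * central_sum p x) (of_int (\<chi> (1 - 4 * y) + \<chi> (1 + 4 * y)))"
proof -
  define h where "h = (p - 1) div 2"
  have p: "p = 2 * h + 1" and quarter: "(p - 1) div 4 = h div 2"
    using odd_p by (auto simp: h_def elim!: oddE)
  have summand: "rat_cong p (of_nat ((4 * k) choose (2 * k)) * x ^ k)
      (of_int (int (h choose (2 * k)) * (4 * y) ^ (2 * k)))" if "k \<le> h div 2" for k
  proof -
    have "[int ((4 * k) choose (2 * k)) = (- 4) ^ (2 * k) * int (h choose (2 * k))] (mod int p)"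
      using central_binomial_cong[OF prime_p p, of "2 * k"] that p by simp
    then have "rat_cong p (of_int (int ((4 * k) choose (2 * k))) * x ^ k)
        (of_int ((- 4) ^ (2 * k) * int (h choose (2 * k))) * (of_int (y\<^sup>2)) ^ k)"
      using assms by (intro rat_cong_mult rat_cong_of_int rat_cong_power)
    also have "\<dots> = of_int (int (h choose (2 * k)) * (4 * y) ^ (2 * k))"
      by (simp add: power_mult power_mult_distrib)
    finally show ?thesis by simp
  qed
  have "rat_cong p (of_int 2 * central_sum p x)
      (of_int 2 * of_int (\<Sum>k = 0..h div 2. int (h choose (2 * k)) * (4 * y) ^ (2 * k)))"
    unfolding central_sum_def quarter of_int_sum
    by (intro rat_cong_scale rat_cong_sum summand) simp
  also have "\<dots> = of_int ((1 - 4 * y) ^ h + (1 + 4 * y) ^ h)"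
    unfolding sum_even_binomial_powers by simp
  also have "rat_cong p \<dots> (of_int (\<chi> (1 - 4 * y) + \<chi> (1 + 4 * y)))"
  proof -
    have "[a ^ h = \<chi> a] (mod int p)" for a
      using euler_criterion_int[OF prime_int_p odd_int_p, of a] by (simp add: p cong_sym_eq)
    then show ?thesis by (intro rat_cong_of_int cong_add)
  qed
  finally show ?thesis by simp
qed

lemma central_sum_cong_sum_squares:
  fixes c d e f :: int
  assumes "int p dvd c\<^sup>2 + d\<^sup>2" "\<not> int p dvd c" "\<not> int p dvd e"
  shows "rat_cong p
    (2 * (of_int (\<chi> (e * c)) * central_sum p (- ((of_int f)\<^sup>2 / (16 * (of_int e)\<^sup>2)))))
    (of_int (\<chi> (e * c - f * d) + \<chi> (e * c + f * d)))"
    (is "rat_cong p (2 * (_ * central_sum p ?x)) _")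
proof -
  have "\<not> int p dvd 4 * e"
    using not_dvd_two_power[of 2] assms(3) by (intro not_dvd_mult) simp_all
  then obtain y where y: "[4 * e * c * y = f * d] (mod int p)"
    and x: "rat_cong p (- ((of_int f)\<^sup>2 / (of_int (4 * e))\<^sup>2)) (of_int (y\<^sup>2))"
    using neg_square_quotient_cong_square[OF assms(1,2)] by blast
  have "rat_cong p (of_int (\<chi> (e * c)) * (2 * central_sum p ?x))
      (of_int (\<chi> (e * c)) * of_int (\<chi> (1 - 4 * y) + \<chi> (1 + 4 * y)))"
    using x by (intro rat_cong_scale central_sum_cong_square) (simp add: power_mult_distrib)
  moreover have "\<chi> (e * c) * \<chi> (1 - 4 * y) = \<chi> (e * c - f * d)"
  proof -
    have "e * c * (1 - 4 * y) = e * c - 4 * e * c * y" by (simp add: algebra_simps)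
    then show ?thesis
      unfolding chi_mult[symmetric] using Legendre_cong[OF cong_diff[OF cong_refl y]] by metis
  qed
  moreover have "\<chi> (e * c) * \<chi> (1 + 4 * y) = \<chi> (e * c + f * d)"
  proof -
    have "e * c * (1 + 4 * y) = e * c + 4 * e * c * y" by (simp add: algebra_simps)
    then show ?thesis
      unfolding chi_mult[symmetric] using Legendre_cong[OF cong_add[OF cong_refl y]] by metis
  qed
  ultimately show ?thesis
    by (simp only: of_int_mult[symmetric] distrib_left mult.left_commute[of 2])
qed

end

section \<open>Primes that are sums of two squares\<close>

locale prime_sum_squares = prime_modulus +
  fixes c d :: int
  assumes p_mod_4: "[p = 1] (mod 4)"
    and p_eq: "int p = c\<^sup>2 + d\<^sup>2"
    and even_d: "even d"
begin

sublocale odd_prime_modulus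
  using p_mod_4 by unfold_locales (simp add: cong_def, presburger)

lemma odd_c: "odd c"
  using odd_int_p even_d by (simp add: p_eq)

lemma coprime_c_d: "coprime c d"
proof (rule coprimeI)
  fix r assume "r dvd c" "r dvd d"
  then have "r\<^sup>2 dvd int p"
    unfolding p_eq by (intro dvd_add dvd_power_same)
  then show "is_unit r"
    using squarefree_prime[OF prime_int_p] by (simp add: squarefree_def)
qed

lemma chi_minus_one: "\<chi> (- 1) = 1"
  using Legendre_minus_one[OF prime_int_p odd_int_p] p_mod_4 cong_int_iff[of p 1 4] by simp

lemma chi_c: "\<chi> c = 1"
  using Jacobi_sum_squares[of d c 1 "int p"] coprime_c_d odd_c odd_int_p prime_int_p
  by (simp add: p_eq[symmetric] add.commute coprime_commute Jacobi_one_left Jacobi_prime prime_gt_0_nat prime_p)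

lemma chi_d: "\<chi> d = \<chi> 2"
proof -
  have not_dvd_c: "\<not> int p dvd c" using chi_c Legendre_eq_0_iff[of c "int p"] by simp
  moreover have "\<not> int p dvd d"
  proof
    assume "int p dvd d"
    then have "int p dvd int p - d\<^sup>2" by (simp add: power2_eq_square)
    then show False using not_dvd_c prime_int_p by (simp add: p_eq prime_dvd_power_iff)
  qed
  ultimately have "\<not> int p dvd 2 * c * d"
    using not_dvd_two_power[of 1] by (intro not_dvd_mult) simp_all
  moreover have cong: "[(c + d)\<^sup>2 = 2 * c * d] (mod int p)"
    unfolding p_eq cong_iff_dvd_diff by (simp add: power2_eq_square algebra_simps)
  ultimately have "\<not> int p dvd c + d"
    by (metis cong_dvd_iff dvd_mult2 power2_eq_square)
  then have "\<chi> (2 * c * d) = 1"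
    using Legendre_cong[OF cong] Legendre_square[OF prime_int_p] by simp
  then have "\<chi> 2 * \<chi> d = 1" by (simp add: chi_mult chi_c)
  then show ?thesis by (auto simp: zmult_eq_1_iff)
qed

lemma chi_two: "\<chi> 2 = (if even (d div 2) then 1 else - 1)"
proof -
  obtain k where k: "d = 2 * k" using even_d by auto
  have "int p = 8 * ((c\<^sup>2 - 1) div 8) + 1 + 4 * k\<^sup>2"
    using odd_square_eq[OF odd_c] by (simp add: p_eq k power_mult_distrib)
  moreover have "(8 * x + 1 + 4 * z) mod 8 \<in> {1, 7} \<longleftrightarrow> even z" for x z :: int
    by simp presburger
  ultimately show ?thesis
    using Legendre_two[OF prime_int_p odd_int_p] by (simp only: k) simp
qed

lemma chi_four_mult: "\<chi> (4 * a) = \<chi> a"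
  using chi_mult[of "2\<^sup>2" a] Legendre_square[OF prime_int_p, of 2] not_dvd_two_power[of 1] by simp

text \<open>Since \<open>(2/p) = (d/p)\<close>, this is multiplication of \<open>uc + vd\<close> by the square root \<open>d/c\<close> of \<open>-1\<close>.\<close>

lemma chi_two_rotate: "\<chi> 2 * \<chi> (u * c + v * d) = \<chi> (v * c - u * d)"
proof -
  have "\<chi> 2 * \<chi> (u * c + v * d) = \<chi> (d * (u * c + v * d))"
    by (simp only: chi_mult chi_d)
  also have "\<dots> = \<chi> (- 1 * (c * (v * c - u * d)))"
  proof (rule Legendre_cong)
    have "d * (u * c + v * d) - - 1 * (c * (v * c - u * d)) = int p * v"
      by (simp add: p_eq power2_eq_square algebra_simps)
    then show "[d * (u * c + v * d) = - 1 * (c * (v * c - u * d))] (mod int p)"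
      by (simp only: cong_iff_dvd_diff dvd_triv_left)
  qed
  also have "\<dots> = \<chi> (v * c - u * d)"
    by (simp only: chi_mult chi_minus_one chi_c mult_1)
  finally show ?thesis .
qed

lemma chi_conjugate_mult: "\<chi> (u * c - v * d) * \<chi> (u * c + v * d) = \<chi> (u\<^sup>2 + v\<^sup>2)"
proof -
  have "\<chi> (u * c - v * d) * \<chi> (u * c + v * d) = \<chi> ((u * c - v * d) * (u * c + v * d))"
    by (simp only: chi_mult)
  also have "\<dots> = \<chi> (c * (c * (u\<^sup>2 + v\<^sup>2)))"
  proof (rule Legendre_cong)
    have "(u * c - v * d) * (u * c + v * d) - c * (c * (u\<^sup>2 + v\<^sup>2)) = int p * - (v\<^sup>2)"
      by (simp add: p_eq power2_eq_square algebra_simps)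
    then show "[(u * c - v * d) * (u * c + v * d) = c * (c * (u\<^sup>2 + v\<^sup>2))] (mod int p)"
      by (simp only: cong_iff_dvd_diff dvd_triv_left)
  qed
  finally show ?thesis by (simp add: chi_mult chi_c)
qed

definition norm_symbol :: "int \<Rightarrow> int \<Rightarrow> int"
  where "norm_symbol u v = (if \<chi> (u\<^sup>2 + v\<^sup>2) = 1 then \<chi> (u * c + v * d) else 0)"

lemma chi_conjugate_add:
  assumes "\<not> int p dvd u\<^sup>2 + v\<^sup>2"
  shows "\<chi> (u * c - v * d) + \<chi> (u * c + v * d) = 2 * norm_symbol u v"
  using assms chi_conjugate_mult[of u v] Legendre_eq_0_iff[of "u\<^sup>2 + v\<^sup>2" "int p"]
    Legendre_range[of "u * c - v * d" "int p"] Legendre_range[of "u * c + v * d" "int p"]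
  by (auto simp: norm_symbol_def)

lemma norm_symbol_swap: "\<chi> 2 * norm_symbol u v = norm_symbol v u"
proof (cases "\<chi> (u\<^sup>2 + v\<^sup>2) = 1")
  case True
  then have "\<chi> (v * c - u * d) = \<chi> (v * c + u * d)"
    using chi_conjugate_mult[of v u] by (auto simp: add.commute zmult_eq_1_iff)
  then show ?thesis
    using True chi_two_rotate[of u v] by (simp add: norm_symbol_def add.commute)
qed (simp add: norm_symbol_def add.commute)

lemma central_sum_cong_norm_symbol:
  assumes "\<not> int p dvd e" "\<not> int p dvd e\<^sup>2 + f\<^sup>2"
  shows "rat_cong p (of_int (\<chi> e) * central_sum p (- ((of_int f)\<^sup>2 / (16 * (of_int e)\<^sup>2))))
    (of_int (norm_symbol e f))"
proof (rule rat_cong_cancel)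
  have "int p dvd c\<^sup>2 + d\<^sup>2" "\<not> int p dvd c"
    using chi_c Legendre_eq_0_iff[of c "int p"] by (simp_all add: p_eq)
  then show "rat_cong p
      (of_int 2 * (of_int (\<chi> e) * central_sum p (- ((of_int f)\<^sup>2 / (16 * (of_int e)\<^sup>2)))))
      (of_int 2 * of_int (norm_symbol e f))"
    using central_sum_cong_sum_squares[of c d e f] assms
    by (simp add: chi_mult chi_c chi_conjugate_add del: of_int_add)
  show "\<not> int p dvd 2" using not_dvd_two_power[of 1] by simp
qed

lemma central_sum_cong_norm_symbol_swap:
  assumes "\<not> int p dvd e" "\<not> int p dvd e\<^sup>2 + f\<^sup>2"
  shows "rat_cong p (of_int (\<chi> (2 * e)) * central_sum p (- ((of_int f)\<^sup>2 / (16 * (of_int e)\<^sup>2))))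
    (of_int (norm_symbol f e))"
  using rat_cong_scale[OF central_sum_cong_norm_symbol[OF assms], of "\<chi> 2"]
  by (simp add: chi_mult mult.assoc flip: norm_symbol_swap[of e f])

lemma chi_eq_Jacobi_mult:
  assumes "coprime u v" "\<not> int p dvd u\<^sup>2 + v\<^sup>2" "u\<^sup>2 + v\<^sup>2 = e * n" "0 < n" "odd n"
    and "odd (u * c + v * d)"
  shows "\<chi> (u * c + v * d) = Jacobi e (u * c + v * d) * Jacobi (u * c + v * d) n"
proof -
  define s t where "s = u * d - v * c" and "t = u * c + v * d"
  have "coprime (c\<^sup>2 + d\<^sup>2) (u\<^sup>2 + v\<^sup>2)"
    using assms(2) by (simp add: p_eq[symmetric] coprime_p_iff coprime_commute[of "int p"])
  then have "coprime s t"
    unfolding s_def t_def using coprime_c_d assms(1) by (intro coprime_Gaussian_product)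
  moreover have "s\<^sup>2 + t\<^sup>2 = (u\<^sup>2 + v\<^sup>2) * int p"
    by (simp add: s_def t_def p_eq power2_eq_square algebra_simps)
  ultimately have "Jacobi e t * Jacobi t (n * int p) = 1"
    using assms(3-6) odd_int_p prime_gt_0_nat[OF prime_p]
    by (intro Jacobi_sum_squares[of s]) (simp_all add: t_def)
  moreover have "Jacobi t (n * int p) = Jacobi t n * \<chi> t"
    using assms(4) prime_int_p by (subst Jacobi_mult_right) (auto simp: Jacobi_prime)
  ultimately have "Jacobi e t * Jacobi t n * \<chi> t = 1" by (simp add: mult.assoc)
  then have "\<chi> t = Jacobi e t * Jacobi t n" by (auto simp: zmult_eq_1_iff)
  then show ?thesis by (simp only: t_def)
qed

lemma chi_eq_Jacobi_odd_even:
  assumes "coprime u v" "\<not> int p dvd u\<^sup>2 + v\<^sup>2" "odd u" "even v"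
  shows "\<chi> (u * c + v * d) = Jacobi (u * c + v * d) (u\<^sup>2 + v\<^sup>2)"
proof -
  have "0 < u\<^sup>2 + v\<^sup>2" using assms(3) by (intro add_pos_nonneg) auto
  then show ?thesis
    using chi_eq_Jacobi_mult[OF assms(1,2), of 1] assms(3,4) odd_c by (simp add: Jacobi_one_left)
qed

lemma chi_eq_Jacobi_odd_odd:
  assumes "coprime u v" "\<not> int p dvd u\<^sup>2 + v\<^sup>2" "odd u" "odd v"
  shows "\<chi> (u * c + v * d)
    = Jacobi 2 (u * c + v * d) * Jacobi (u * c + v * d) ((u\<^sup>2 + v\<^sup>2) div 2)"
proof (rule chi_eq_Jacobi_mult[OF assms(1,2)])
  have "u\<^sup>2 + v\<^sup>2 = 2 * (4 * ((u\<^sup>2 - 1) div 8 + (v\<^sup>2 - 1) div 8) + 1)"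
    using odd_square_eq[OF assms(3)] odd_square_eq[OF assms(4)] by simp
  then show "u\<^sup>2 + v\<^sup>2 = 2 * ((u\<^sup>2 + v\<^sup>2) div 2)" "odd ((u\<^sup>2 + v\<^sup>2) div 2)"
    by simp_all
  moreover have "0 < u\<^sup>2 + v\<^sup>2" using assms(3) by (intro add_pos_nonneg) auto
  ultimately show "0 < (u\<^sup>2 + v\<^sup>2) div 2" by linarith
  show "odd (u * c + v * d)" using assms(3) odd_c even_d by simp
qed

lemma chi_eq_Jacobi_four_dvd:
  assumes "coprime b m" "\<not> int p dvd b\<^sup>2 + 4 * m\<^sup>2" "4 dvd b"
  shows "\<chi> (b * c + 2 * m * d) = Jacobi (m * c - b div 2 * d) (b\<^sup>2 div 4 + m\<^sup>2)"
proof -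
  obtain k where b: "b = 2 * k" and k: "even k" using assms(3) by auto
  have m: "coprime m (- k)" "odd m"
    using assms(1) k by (auto simp: b coprime_commute)
  have not_dvd: "\<not> int p dvd m\<^sup>2 + (- k)\<^sup>2"
    using assms(2) dvd_mult[of "int p" "m\<^sup>2 + k\<^sup>2" 4]
    by (auto simp: b power_mult_distrib algebra_simps)
  have "\<chi> (b * c + 2 * m * d) = \<chi> (2 * (k * c + m * d))"
    by (simp add: b algebra_simps)
  also have "\<dots> = \<chi> (m * c - k * d)"
    by (simp only: chi_mult[of 2] chi_two_rotate)
  also have "\<dots> = Jacobi (m * c - k * d) (m\<^sup>2 + k\<^sup>2)"
    using chi_eq_Jacobi_odd_even[OF m(1) not_dvd m(2)] k by simp
  finally show ?thesis by (simp add: b power_mult_distrib add.commute)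
qed

lemma chi_eq_Jacobi_two_exactly_dvd:
  assumes "coprime b m" "\<not> int p dvd b\<^sup>2 + 4 * m\<^sup>2" "2 dvd b" "\<not> 4 dvd b"
  shows "of_int (\<chi> (b * c + 2 * m * d)) =
    (- 1 :: rat) powi (((b div 2 * c + m * d)\<^sup>2 - 1) div 8 + d div 2) *
    of_int (Jacobi (b div 2 * c + m * d) (((b div 2)\<^sup>2 + m\<^sup>2) div 2))"
proof -
  obtain k where b: "b = 2 * k" using assms(3) by auto
  have odd: "odd k" "odd m" using assms(1,4) by (auto simp: b)
  have not_dvd: "\<not> int p dvd k\<^sup>2 + m\<^sup>2"
    using assms(2) dvd_mult[of "int p" "k\<^sup>2 + m\<^sup>2" 4]
    by (auto simp: b power_mult_distrib algebra_simps)
  define t where "t = k * c + m * d"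
  have "odd t" using odd odd_c even_d by (simp add: t_def)
  then have sign: "of_int (\<chi> 2 * Jacobi 2 t) = (- 1 :: rat) powi ((t\<^sup>2 - 1) div 8 + d div 2)"
    by (simp add: chi_two Jacobi_two power_int_minus_left)
  have "\<chi> (b * c + 2 * m * d) = \<chi> (2 * t)"
    by (simp add: b t_def algebra_simps)
  also have "\<dots> = \<chi> 2 * \<chi> t" by (rule chi_mult)
  also have "\<chi> t = Jacobi 2 t * Jacobi t ((k\<^sup>2 + m\<^sup>2) div 2)"
    unfolding t_def using assms(1) by (intro chi_eq_Jacobi_odd_odd not_dvd odd) (simp add: b)
  finally have "of_int (\<chi> (b * c + 2 * m * d))
      = (of_int (\<chi> 2 * Jacobi 2 t) * of_int (Jacobi t ((k\<^sup>2 + m\<^sup>2) div 2)) :: rat)"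
    by simp
  then show ?thesis unfolding sign by (simp add: b t_def)
qed

lemma norm_symbol_eq_Jacobi:
  assumes "coprime b m" "\<not> int p dvd b\<^sup>2 + 4 * m\<^sup>2"
  shows "(if odd b \<and> \<chi> (b\<^sup>2 + 4 * m\<^sup>2) = 1
        then of_int (Jacobi (b * c + 2 * m * d) (b\<^sup>2 + 4 * m\<^sup>2))
      else if 2 dvd b \<and> \<not> 4 dvd b \<and> \<chi> (b\<^sup>2 + 4 * m\<^sup>2) = 1
        then (- 1) powi (((b div 2 * c + m * d)\<^sup>2 - 1) div 8 + d div 2) *
             of_int (Jacobi (b div 2 * c + m * d) (((b div 2)\<^sup>2 + m\<^sup>2) div 2))
      else if 4 dvd b \<and> \<chi> (b\<^sup>2 + 4 * m\<^sup>2) = 1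
        then of_int (Jacobi (m * c - b div 2 * d) (b\<^sup>2 div 4 + m\<^sup>2))
      else 0) = rat_of_int (norm_symbol b (2 * m))"
proof (cases "\<chi> (b\<^sup>2 + 4 * m\<^sup>2) = 1")
  case True
  then have symbol: "norm_symbol b (2 * m) = \<chi> (b * c + 2 * m * d)"
    by (simp add: norm_symbol_def power_mult_distrib)
  consider (odd) "odd b" | (two_exactly) "2 dvd b" "\<not> 4 dvd b" | (four) "4 dvd b" "2 dvd b"
    using dvd_trans[of 2 4 b] by auto
  then show ?thesis
  proof cases
    case odd
    then show ?thesis
      using True symbol assms chi_eq_Jacobi_odd_even[of b "2 * m"] by (simp add: power_mult_distrib)
  next
    case two_exactly
    then show ?thesis
      using True symbol chi_eq_Jacobi_two_exactly_dvd[OF assms] by simp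
  next
    case four
    then show ?thesis
      using True symbol chi_eq_Jacobi_four_dvd[OF assms] by simp
  qed
qed (simp add: norm_symbol_def power_mult_distrib)

lemma norm_symbol_one_eq_Jacobi:
  assumes "\<not> int p dvd 16 * a\<^sup>2 + 1"
  shows "(if \<chi> (16 * a\<^sup>2 + 1) = 1 then of_int (Jacobi (c - 4 * a * d) (16 * a\<^sup>2 + 1)) else 0)
    = rat_of_int (norm_symbol 1 (- 4 * a))"
  using assms chi_eq_Jacobi_odd_even[of 1 "- 4 * a"]
  by (simp add: norm_symbol_def power_mult_distrib add.commute)

lemma central_sums_cong_norm_symbol:
  assumes "\<not> int p dvd m * (b\<^sup>2 + 4 * m\<^sup>2)"
  shows "rat_cong p (of_int (\<chi> m) * central_sum p (- ((of_int b)\<^sup>2 / (64 * (of_int m)\<^sup>2))))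
      (of_int (norm_symbol b (2 * m)))"
    and "\<not> int p dvd b \<Longrightarrow>
      rat_cong p (of_int (\<chi> b) * central_sum p (- ((of_int m)\<^sup>2 / (4 * (of_int b)\<^sup>2))))
        (of_int (norm_symbol b (2 * m)))"
proof -
  have not_dvd: "\<not> int p dvd 2 * m" "\<not> int p dvd (2 * m)\<^sup>2 + b\<^sup>2"
    using assms not_dvd_two_power[of 1] prime_int_p
    by (auto simp: power_mult_distrib add.commute prime_dvd_mult_iff)
  show "rat_cong p (of_int (\<chi> m) * central_sum p (- ((of_int b)\<^sup>2 / (64 * (of_int m)\<^sup>2))))
      (of_int (norm_symbol b (2 * m)))"
    using central_sum_cong_norm_symbol_swap[OF not_dvd] chi_four_mult[of m]
    by (simp add: power_mult_distrib)
  show "rat_cong p (of_int (\<chi> b) * central_sum p (- ((of_int m)\<^sup>2 / (4 * (of_int b)\<^sup>2))))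
      (of_int (norm_symbol b (2 * m)))" if "\<not> int p dvd b"
    using central_sum_cong_norm_symbol[OF that, of "2 * m"] not_dvd(2)
    by (simp add: power_mult_distrib add.commute)
qed

lemma central_sums_cong_norm_symbol_one:
  assumes "\<not> int p dvd 16 * a\<^sup>2 + 1"
  shows "rat_cong p (central_sum p (- ((of_int a)\<^sup>2))) (of_int (norm_symbol 1 (- 4 * a)))"
    and "\<not> int p dvd a \<Longrightarrow>
      rat_cong p (of_int (\<chi> (2 * a)) * central_sum p (1 / (- 256 * (of_int a)\<^sup>2)))
        (of_int (norm_symbol 1 (- 4 * a)))"
proof -
  show "rat_cong p (central_sum p (- ((of_int a)\<^sup>2))) (of_int (norm_symbol 1 (- 4 * a)))"
    using central_sum_cong_norm_symbol[of 1 "- 4 * a"] assms Jacobi_one_left[of "int p"]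
      not_dvd_two_power[of 0] prime_int_p
    by (simp add: Jacobi_prime power_mult_distrib add.commute)
  assume "\<not> int p dvd a"
  then have "\<not> int p dvd - 4 * a"
    using not_dvd_two_power[of 2] by (intro not_dvd_mult) simp_all
  moreover have "\<chi> (2 * (- 4 * a)) = \<chi> (2 * a)"
    using chi_four_mult[of "2 * a"] chi_mult[of "- 1"] chi_minus_one by simp
  ultimately show "rat_cong p (of_int (\<chi> (2 * a)) * central_sum p (1 / (- 256 * (of_int a)\<^sup>2)))
      (of_int (norm_symbol 1 (- 4 * a)))"
    using central_sum_cong_norm_symbol_swap[of "- 4 * a" 1] assms
    by (simp add: power_mult_distrib)
qed

end

theorem theorem2p10:
  fixes p :: nat and c d :: int
  assumes "prime p" and "[p = 1] (mod 4)" and "int p = c\<^sup>2 + d\<^sup>2" and "2 dvd d"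
  shows
    "(\<forall>b m :: int. coprime b m \<longrightarrow> \<not> int p dvd m * (b\<^sup>2 + 4 * m\<^sup>2) \<longrightarrow>
       (let A = of_int (Legendre m (int p)) * central_sum p (- ((of_int b)\<^sup>2 / (64 * (of_int m)\<^sup>2)));
            B = of_int (Legendre b (int p)) * central_sum p (- ((of_int m)\<^sup>2 / (4 * (of_int b)\<^sup>2)));
            C = (if odd b \<and> Legendre (b\<^sup>2 + 4 * m\<^sup>2) (int p) = 1
                   then of_int (Jacobi (b * c + 2 * m * d) (b\<^sup>2 + 4 * m\<^sup>2))
                 else if 2 dvd b \<and> \<not> 4 dvd b \<and> Legendre (b\<^sup>2 + 4 * m\<^sup>2) (int p) = 1
                   then (- 1) powi (((b div 2 * c + m * d)\<^sup>2 - 1) div 8 + d div 2) *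
                        of_int (Jacobi (b div 2 * c + m * d) (((b div 2)\<^sup>2 + m\<^sup>2) div 2))
                 else if 4 dvd b \<and> Legendre (b\<^sup>2 + 4 * m\<^sup>2) (int p) = 1
                   then of_int (Jacobi (m * c - b div 2 * d) (b\<^sup>2 div 4 + m\<^sup>2))
                 else 0)
        in rat_cong p A C \<and> (\<not> int p dvd b \<longrightarrow> rat_cong p A B \<and> rat_cong p B C))) \<and>
     (\<forall>a :: int. \<not> int p dvd 16 * a\<^sup>2 + 1 \<longrightarrow>
       (let A = central_sum p (- ((of_int a)\<^sup>2));
            B = of_int (Legendre (2 * a) (int p)) * central_sum p (1 / (- 256 * (of_int a)\<^sup>2));
            C = (if Legendre (16 * a\<^sup>2 + 1) (int p) = 1
                   then of_int (Jacobi (c - 4 * a * d) (16 * a\<^sup>2 + 1))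
                 else 0)
        in rat_cong p A C \<and> (\<not> int p dvd a \<longrightarrow> rat_cong p A B \<and> rat_cong p B C)))"
proof -
  interpret prime_sum_squares p c d
    using assms by unfold_locales
  show ?thesis
    unfolding Let_def
  proof ((rule conjI; intro allI impI), goal_cases)
    case (1 b m)
    then have not_dvd: "\<not> int p dvd b\<^sup>2 + 4 * m\<^sup>2" by auto
    show ?case
      unfolding norm_symbol_eq_Jacobi[OF 1(1) not_dvd]
      by (intro rat_cong_common_value central_sums_cong_norm_symbol 1(2))
  next
    case (2 a)
    show ?case
      unfolding norm_symbol_one_eq_Jacobi[OF 2]
      by (intro rat_cong_common_value central_sums_cong_norm_symbol_one 2)
  qed
qed

end
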